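(* Let $\Sigma$ be a (finite or infinite) totally ordered alphabet, and let $LS \subseteq \Sigma^{*}$ be a set of words with $\varepsilon \in LS$. Call a word $w \in LS$ an orphan path if some prefix of $w$ does not belong to $LS$, and a non-orphan path otherwise. Let $LT$ be the set obtained as follows: first put every non-orphan path of $LS$ into $LT$; then, for every orphan path $w = a_1 a_2 \cdots a_n \in LS$ (with $a_i \in \Sigma$), processed in order of increasing length and, among words of equal length, in the order induced by $\Sigma$, apply one fixed policy among the following four (the same policy for all orphan paths): \begin{itemize} \item skip: add nothing to $LT$ for $w$; \item reappear: add to $LT$ all prefixes $a_1 \cdots a_j$ for $j \in [1,n]$; \item root: add to $LT$ the word $a_j \cdots a_n$, where $j$ is the index such that $a_1 \cdots a_{j-1} \notin LS$ and $a_1 \cdots a_k \in LS$ for all $k \in [j,n]$; \item compact: add to $LT$ the word $a_1 \cdots a_m a_j \cdots a_n$, where $j$ is as in the root policy and $m < j$ is such that $a_1 \cdots a_m$ is a non-orphan path (hence in $LT$) and $a_1 \cdots a_{m+1} \notin LS$. \end{itemize} Then, for each of the four policies: (i) $LT$ is a word tree, i.e. $\varepsilon \in LT$ and for all $p, e \in \Sigma^{*}$, $pe \in LT$ implies $p \in LT$; and (ii) $LT$ is eventually consistent: $LT$ is determined by $LS$ (and the chosen policy), so if the lookup sets $LS$ held by the replicas eventually coincide, the computed sets $LT$ eventually coincide as well.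
   Context: Setting: a replicated tree is represented as a "word tree", i.e. the set of all its root-to-node paths, each path being a word over the alphabet $\Sigma$; the empty word $\varepsilon$ represents the root. $\Sigma^{*}$ denotes the set of finite words over $\Sigma$. Paths are stored in an eventually consistent replicated set (a set CRDT); $LS$ denotes the set of paths currently visible in that replicated set (its "lookup"). Because of concurrent additions of a path and removals of one of its prefixes, $LS$ need not be prefix-closed, so a tree $LT$ is computed from $LS$ by one of the listed "connection policies". Eventual consistency means that replicas which have received the same updates end up with identical values; the underlying set CRDT guarantees that $LS$ is eventually consistent. *)

theory Defs
  imports Complex_Main "HOL-Library.Sublist"
begin

text \<open>Words over \<open>\<Sigma>\<close> are lists over a linearly ordered type; if \<open>w = a\<^sub>1 \<dots> a\<^sub>n\<close> then
  \<open>take k w = a\<^sub>1 \<dots> a\<^sub>k\<close> and \<open>drop (j - 1) w = a\<^sub>j \<dots> a\<^sub>n\<close>.\<close>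

definition orphan :: "'a list set \<Rightarrow> 'a list \<Rightarrow> bool" where
  "orphan LS w \<longleftrightarrow> w \<in> LS \<and> (\<exists>p. prefix p w \<and> p \<notin> LS)"

definition non_orphan :: "'a list set \<Rightarrow> 'a list \<Rightarrow> bool" where
  "non_orphan LS w \<longleftrightarrow> w \<in> LS \<and> \<not> orphan LS w"

definition word_tree :: "'a list set \<Rightarrow> bool" where
  "word_tree T \<longleftrightarrow> [] \<in> T \<and> (\<forall>p e. p @ e \<in> T \<longrightarrow> p \<in> T)"

datatype policy = Skip | Reappear | Root | Compact

definition reattach_index :: "'a list set \<Rightarrow> 'a list \<Rightarrow> nat \<Rightarrow> bool" where
  "reattach_index LS w j \<longleftrightarrow>
     j \<in> {1..length w} \<and> take (j - 1) w \<notin> LS \<and> (\<forall>k\<in>{j..length w}. take k w \<in> LS)"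

text \<open>\<open>policy_adds P LS w A\<close>: treating the orphan path \<open>w\<close> with policy \<open>P\<close> adds the words in \<open>A\<close>.
  This is a relation, so that existence and uniqueness of the indices \<open>j\<close> and \<open>m\<close>
  are not built into the definition.\<close>

inductive policy_adds :: "policy \<Rightarrow> 'a list set \<Rightarrow> 'a list \<Rightarrow> 'a list set \<Rightarrow> bool" where
  skip: "policy_adds Skip LS w {}"
| reappear: "policy_adds Reappear LS w {take j w | j. j \<in> {1..length w}}"
| root: "reattach_index LS w j \<Longrightarrow> policy_adds Root LS w {drop (j - 1) w}"
| compact: "\<lbrakk>reattach_index LS w j; m < j; non_orphan LS (take m w); take (m + 1) w \<notin> LS\<rbrakk>
    \<Longrightarrow> policy_adds Compact LS w {take m w @ drop (j - 1) w}"

text \<open>Increasing length, then lexicographically within each length.\<close>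

definition word_order :: "('a::linorder) list rel" where
  "word_order = lenlex {(x, y). x < y}"

text \<open>The set obtained once all orphan paths up to and including \<open>w\<close> have been treated, when the
  treatment of each orphan path \<open>v\<close> adds \<open>A v\<close>.  It is given by the accumulated additions and not
  by recursion along \<^const>\<open>word_order\<close>, which need not be well-founded on an infinite \<open>LS\<close> over
  an infinite alphabet.\<close>

definition tree_upto :: "'a::linorder list set \<Rightarrow> ('a list \<Rightarrow> 'a list set) \<Rightarrow> 'a list \<Rightarrow> 'a list set" where
  "tree_upto LS A w =
     {v. non_orphan LS v} \<union> (\<Union>v\<in>{v. orphan LS v \<and> (v = w \<or> (v, w) \<in> word_order)}. A v)"

definition computed_tree :: "policy \<Rightarrow> 'a::linorder list set \<Rightarrow> 'a list set \<Rightarrow> bool" where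
  "computed_tree P LS LT \<longleftrightarrow>
     (\<exists>A. (\<forall>w. orphan LS w \<longrightarrow> policy_adds P LS w (A w)) \<and>
          LT = {v. non_orphan LS v} \<union> (\<Union>w\<in>{w. orphan LS w}. tree_upto LS A w))"

text \<open>If there are finitely many orphan paths, this is the literal sequential process.\<close>

inductive process :: "policy \<Rightarrow> 'a list set \<Rightarrow> 'a list list \<Rightarrow> 'a list set \<Rightarrow> 'a list set \<Rightarrow> bool"
  for P :: policy and LS :: "'a list set" where
  stop: "process P LS [] T T"
| step: "\<lbrakk>policy_adds P LS w B; process P LS ws (T \<union> B) T'\<rbrakk> \<Longrightarrow> process P LS (w # ws) T T'"

lemma process_iff:
  assumes "distinct ws"
  shows "process P LS ws T T' \<longleftrightarrow>
    (\<exists>A. (\<forall>w\<in>set ws. policy_adds P LS w (A w)) \<and> T' = T \<union> (\<Union>w\<in>set ws. A w))"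
  using assms
proof (induction ws arbitrary: T)
  case Nil
  then show ?case by (auto intro: process.stop elim: process.cases)
next
  case (Cons w ws)
  have "process P LS (w # ws) T T' \<longleftrightarrow>
      (\<exists>B. policy_adds P LS w B \<and> process P LS ws (T \<union> B) T')"
    by (auto intro: process.step elim: process.cases)
  also have "\<dots> \<longleftrightarrow> (\<exists>B. policy_adds P LS w B \<and>
      (\<exists>A. (\<forall>v\<in>set ws. policy_adds P LS v (A v)) \<and> T' = T \<union> B \<union> (\<Union>v\<in>set ws. A v)))"
    using Cons by simp
  also have "\<dots> \<longleftrightarrow> (\<exists>A. (\<forall>v\<in>set (w # ws). policy_adds P LS v (A v)) \<and>
      T' = T \<union> (\<Union>v\<in>set (w # ws). A v))" (is "?L \<longleftrightarrow> ?R")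
  proof
    assume ?L
    then obtain B A where BA: "policy_adds P LS w B" "\<forall>v\<in>set ws. policy_adds P LS v (A v)"
      "T' = T \<union> B \<union> (\<Union>v\<in>set ws. A v)" by blast
    have "w \<notin> set ws" using Cons.prems by simp
    then have eq: "v \<in> set ws \<Longrightarrow> (A(w := B)) v = A v" for v by auto
    then have un: "(\<Union>v\<in>set ws. (A(w := B)) v) = (\<Union>v\<in>set ws. A v)" by (rule SUP_cong[OF refl])
    have "\<forall>v\<in>set (w # ws). policy_adds P LS v ((A(w := B)) v)" using BA eq by auto
    moreover have "T' = T \<union> (\<Union>v\<in>set (w # ws). (A(w := B)) v)"
      unfolding list.set UN_insert un using BA(3) by (simp add: Un_assoc)
    ultimately show ?R by blast
  next
    assume ?R
    then obtain A where "\<forall>v\<in>set (w # ws). policy_adds P LS v (A v)"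
      "T' = T \<union> (\<Union>v\<in>set (w # ws). A v)" by blast
    then show ?L by (intro exI[of _ "A w"] conjI exI[of _ A]) auto
  qed
  finally show ?case .
qed

lemma computed_tree_iff_process:
  assumes "sorted_wrt (\<lambda>v w. (v, w) \<in> word_order) ws" and "set ws = {w. orphan LS w}"
  shows "computed_tree P LS LT \<longleftrightarrow> process P LS ws {v. non_orphan LS v} LT"
proof -
  have "irrefl (word_order :: 'a list rel)"
    unfolding word_order_def irrefl_def by (auto intro!: lenlex_irreflexive)
  then have "distinct ws"
    using assms(1) by (induction ws) (auto simp: irrefl_def)
  moreover have "{v. non_orphan LS v} \<union> (\<Union>w\<in>set ws. tree_upto LS A w)
      = {v. non_orphan LS v} \<union> (\<Union>w\<in>set ws. A w)" for A
    using assms(2) by (auto simp: tree_upto_def)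
  ultimately show ?thesis
    using assms(2) by (simp add: process_iff computed_tree_def)
qed

text \<open>\<open>V r t\<close> is the value held by replica \<open>r\<close> at time \<open>t\<close>, and \<open>U r t\<close> the set of updates it has
  received by then.\<close>

definition eventually_coincide :: "'r set \<Rightarrow> ('r \<Rightarrow> nat \<Rightarrow> 'v) \<Rightarrow> bool" where
  "eventually_coincide R V \<longleftrightarrow> (\<forall>\<^sub>F t in sequentially. \<forall>r\<in>R. \<forall>s\<in>R. V r t = V s t)"

definition eventually_consistent ::
    "('r \<Rightarrow> nat \<Rightarrow> 'u set) \<Rightarrow> ('r \<Rightarrow> nat \<Rightarrow> 'v) \<Rightarrow> bool" where
  "eventually_consistent U V \<longleftrightarrow>
     (\<forall>R. eventually_coincide R U \<longrightarrow> eventually_coincide R V)"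

end

theory Submission imports Defs begin

text \<open>Both indices of the policies are determined: \<open>j - 1\<close> is the length of the longest missing
  prefix of the orphan path \<open>w\<close>, and \<open>m + 1\<close> the length of the shortest one.  Hence the treatment of
  every orphan path, and with it the computed tree, is a function of \<open>LS\<close>.  For prefix-closure, a
  prefix of a word added for \<open>w\<close> that ends inside the reattached part \<open>a\<^sub>j \<dots> a\<^sub>n\<close> is the word
  added for a prefix \<open>a\<^sub>1 \<dots> a\<^sub>k\<close> of \<open>w\<close> with \<open>k \<ge> j\<close>, which is itself an orphan path with the same
  indices.\<close>

section \<open>Orphan paths in terms of prefix lengths\<close>

lemma non_orphan_iff: "non_orphan LS w \<longleftrightarrow> (\<forall>k. take k w \<in> LS)"
proof
  assume "non_orphan LS w"
  then show "\<forall>k. take k w \<in> LS"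
    unfolding non_orphan_def orphan_def using take_is_prefix by blast
next
  assume *: "\<forall>k. take k w \<in> LS"
  have "w \<in> LS" using *[rule_format, of "length w"] by simp
  moreover have "p \<in> LS" if "prefix p w" for p
    using *[rule_format, of "length p"] that by (auto simp: prefix_def)
  ultimately show "non_orphan LS w"
    unfolding non_orphan_def orphan_def by blast
qed

lemma orphan_iff: "orphan LS w \<longleftrightarrow> w \<in> LS \<and> (\<exists>k. take k w \<notin> LS)"
  using non_orphan_iff[of LS w] by (auto simp: non_orphan_def orphan_def)

lemma non_orphan_append: "non_orphan LS (p @ e) \<Longrightarrow> non_orphan LS p"
  unfolding non_orphan_def orphan_def by (meson prefixI prefix_order.trans)

lemma non_orphan_Nil: "[] \<in> LS \<Longrightarrow> non_orphan LS []"
  by (simp add: non_orphan_iff)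

section \<open>The reattachment index \<open>j\<close>\<close>

lemma reattach_index_unique:
  assumes "reattach_index LS w i" "reattach_index LS w j"
  shows "i = j"
proof -
  have "\<not> a < b" if "reattach_index LS w a" "reattach_index LS w b" for a b
  proof
    assume "a < b"
    \<comment> \<open>The run of present prefixes starting at \<open>a\<close> covers length
      \<open>b - 1\<close>, the very length at which \<open>b\<close> demands a missing
      prefix.\<close>
    then have "b - 1 \<in> {a..length w}" using that by (auto simp: reattach_index_def)
    then show False using that unfolding reattach_index_def by blast
  qed
  then show ?thesis using assms by (meson linorder_neqE_nat)
qed

lemma reattach_index_exists:
  assumes "orphan LS w"
  shows "\<exists>j. reattach_index LS w j"
proof -
  let ?Q = "\<lambda>i. i \<le> length w \<and> take i w \<notin> LS"
  obtain k where "take k w \<notin> LS" using assms by (auto simp: orphan_iff)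
  \<comment> \<open>\<open>Greatest\<close> needs a bounded predicate. Capping at
    \<open>length w\<close> is harmless, since \<open>take\<close> returns all of \<open>w\<close>
    beyond it.\<close>
  then have Q: "?Q (min k (length w))" by (cases "k \<le> length w") (auto simp: min_def)
  let ?i = "Greatest ?Q"
  have i: "?Q ?i" by (rule GreatestI_nat[of ?Q, OF Q, of "length w"]) auto
  have max: "k \<le> ?i" if "?Q k" for k by (rule Greatest_le_nat[of ?Q, OF that, of "length w"]) auto
  \<comment> \<open>Since \<open>w\<close> itself is present, the longest gap is a proper prefix and
    \<open>Suc ?i\<close> stays within \<open>{1..length w}\<close>.\<close>
  have "?i \<noteq> length w" using i assms by (auto simp: orphan_iff)
  moreover have "take k w \<in> LS" if "Suc ?i \<le> k" "k \<le> length w" for k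
    using max[of k] that by (meson not_less_eq_eq)
  ultimately have "reattach_index LS w (Suc ?i)"
    using i by (auto simp: reattach_index_def)
  then show ?thesis ..
qed

text \<open>Cutting at \<open>k\<close> leaves all prefixes of length at most \<open>k\<close>
  unchanged, so both the gap before \<open>j\<close> and the run from \<open>j\<close> on survive.
  This supplies the shorter orphan paths used for prefix closure.\<close>

lemma reattach_index_take:
  assumes "reattach_index LS w j" "j \<le> k" "k \<le> length w"
  shows "reattach_index LS (take k w) j"
  using assms by (auto simp: reattach_index_def min_def)

lemma reattach_index_imp_orphan: "reattach_index LS w j \<Longrightarrow> orphan LS w"
  unfolding reattach_index_def orphan_iff
  by (metis atLeastAtMost_iff order_refl take_all_iff)

section \<open>The attachment index \<open>m\<close>\<close>

lemma attach_point_unique: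
  assumes "non_orphan LS (take m w)" "take (m + 1) w \<notin> LS"
    and "non_orphan LS (take n w)" "take (n + 1) w \<notin> LS"
  shows "m = n"
proof -
  have "\<not> a < b" if "take (a + 1) w \<notin> LS" "non_orphan LS (take b w)" for a b
  proof
    assume "a < b"
    \<comment> \<open>The missing prefix of length \<open>a + 1\<close> would also be a prefix of
      the non-orphan path \<open>take b w\<close>.\<close>
    then have "take (a + 1) (take b w) = take (a + 1) w" by (simp add: min_def)
    then show False using that by (metis non_orphan_iff)
  qed
  then show ?thesis using assms by (meson linorder_neqE_nat)
qed

lemma attach_point_exists:
  assumes "[] \<in> LS" "reattach_index LS w j"
  shows "\<exists>m<j. non_orphan LS (take m w) \<and> take (m + 1) w \<notin> LS"
proof -
  let ?Q = "\<lambda>i. take i w \<notin> LS"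
  have Q: "?Q (j - 1)" using assms(2) by (simp add: reattach_index_def)
  let ?i = "Least ?Q"
  have i: "?Q ?i" using Q by (rule LeastI)
  have le: "?i \<le> j - 1" using Q by (rule Least_le)
  \<comment> \<open>The witness for \<open>m\<close> is \<open>?i - 1\<close>. Presence of the empty
    word keeps this subtraction from truncating at 0.\<close>
  have pos: "?i \<noteq> 0" using i assms(1) by (metis take0)
  have "take k w \<in> LS" if "k < ?i" for k using not_less_Least[OF that] by simp
  then have "non_orphan LS (take (?i - 1) w)"
    using pos by (auto simp: non_orphan_iff take_take min_def)
  moreover have "?i - 1 < j" "take (?i - 1 + 1) w \<notin> LS" using le pos i by auto
  ultimately show ?thesis by blast
qed

section \<open>Existence and uniqueness of the added words\<close>

lemma policy_adds_exists:
  assumes "[] \<in> LS" "orphan LS w"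
  shows "\<exists>B. policy_adds P LS w B"
proof -
  obtain j where j: "reattach_index LS w j"
    using reattach_index_exists[OF assms(2)] by blast
  obtain m where "m < j" "non_orphan LS (take m w)" "take (m + 1) w \<notin> LS"
    using attach_point_exists[OF assms(1) j] by blast
  then show ?thesis using j by (cases P) (blast intro: policy_adds.intros)+
qed

lemma policy_adds_unique:
  assumes "policy_adds P LS w B" "policy_adds P LS w C"
  shows "B = C"
  using assms
proof (induction rule: policy_adds.induct)
  case (skip LS w)
  then show ?case by (auto elim: policy_adds.cases)
next
  case (reappear LS w)
  then show ?case by (cases rule: policy_adds.cases) auto
next
  case (root LS w j)
  from root(2) root(1) show ?case
    by (cases rule: policy_adds.cases) (auto dest: reattach_index_unique)
next
  case (compact LS w j m)
  from compact(5) obtain i n where "reattach_index LS w i" "non_orphan LS (take n w)"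
    "take (n + 1) w \<notin> LS" "C = {take n w @ drop (i - 1) w}"
    by (cases rule: policy_adds.cases) auto
  then show ?case
    using compact(1,3,4) reattach_index_unique attach_point_unique by metis
qed

section \<open>Prefix closure of the added words\<close>

lemma prefix_of_drop_reattach_index:
  assumes j: "reattach_index LS w j" and pe: "p @ e = drop (j - 1) w" and "p \<noteq> []"
  obtains k where "j \<le> k" "k \<le> length w" "p = drop (j - 1) (take k w)"
proof
  \<comment> \<open>Position in \<open>w\<close> of the last letter of \<open>p\<close>;
    nonemptiness of \<open>p\<close> puts it at or after \<open>j\<close>.\<close>
  let ?k = "j - 1 + length p"
  have len: "length p + length e = length w - (j - 1)"
    using arg_cong[OF pe, of length] by simp
  have "length p > 0" using \<open>p \<noteq> []\<close> by simp
  then show "j \<le> ?k" by linarith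
  show "?k \<le> length w" using len \<open>length p > 0\<close> by linarith
  have "p = take (length p) (drop (j - 1) w)" unfolding pe[symmetric] by simp
  then show "p = drop (j - 1) (take ?k w)" by (simp add: take_drop add.commute)
qed

text \<open>The orphan path responsible for \<open>p\<close> may be a proper prefix of
  \<open>w\<close>, hence the new \<open>v\<close> and \<open>C\<close>. The non-orphan alternative
  absorbs the empty word and prefixes of the attachment part.\<close>

lemma policy_adds_prefix:
  assumes "policy_adds P LS w B" "[] \<in> LS" "orphan LS w" "p @ e \<in> B"
  shows "non_orphan LS p \<or> (\<exists>v C. orphan LS v \<and> policy_adds P LS v C \<and> p \<in> C)"
  using assms
proof (induction rule: policy_adds.induct)
  case (skip LS w)
  then show ?case by simp
next
  case (reappear LS w)
  then obtain j where j: "j \<le> length w" "p @ e = take j w" by auto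
  have "p = take (length p) (take j w)" unfolding j(2)[symmetric] by simp
  moreover have "length p \<le> j" using arg_cong[OF j(2), of length] j(1) by simp
  ultimately have "p = take (length p) w" by (simp add: min_absorb1)
  moreover have "length p \<le> length w" using \<open>length p \<le> j\<close> j(1) by simp
  \<comment> \<open>The empty word is set apart because Reappear only adds prefixes of length at
    least 1.\<close>
  ultimately have "p = [] \<or> p \<in> {take j w |j. j \<in> {1..length w}}"
    by (cases "p = []") (auto simp: Suc_le_eq)
  then show ?case
    using reappear.prems non_orphan_Nil policy_adds.reappear by blast
next
  case (root LS w j)
  show ?case
  proof (cases "p = []")
    case True
    then show ?thesis using root.prems non_orphan_Nil by blast
  next
    case False
    then obtain k where k: "j \<le> k" "k \<le> length w" "p = drop (j - 1) (take k w)"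
      using prefix_of_drop_reattach_index[OF root(1)] root.prems by blast
    have "reattach_index LS (take k w) j" using reattach_index_take root(1) k by blast
    then show ?thesis using k(3) policy_adds.root reattach_index_imp_orphan by blast
  qed
next
  case (compact LS w j m)
  have pe: "p @ e = take m w @ drop (j - 1) w" using compact.prems by simp
  then consider us where "take m w = p @ us"
    | q where "p = take m w @ q" "q @ e = drop (j - 1) w"
    by (metis append_eq_append_conv2)
  then show ?case
  proof cases
    case 1
    then show ?thesis using compact.hyps(3) non_orphan_append by metis
  next
    case 2
    show ?thesis
    proof (cases "q = []")
      case True
      then show ?thesis using 2 compact.hyps by simp
    next
      case False
      then obtain k where k: "j \<le> k" "k \<le> length w" "q = drop (j - 1) (take k w)"
        using prefix_of_drop_reattach_index[OF compact(1) 2(2)] by blast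
      have j: "reattach_index LS (take k w) j" using reattach_index_take compact(1) k by blast
      \<comment> \<open>From \<open>m < j\<close> and \<open>j \<le> k\<close> follows
        \<open>m + 1 \<le> k\<close>, so \<open>take k w\<close> has the same attachment index as
        \<open>w\<close>.\<close>
      have t: "take m (take k w) = take m w" "take (m + 1) (take k w) = take (m + 1) w"
        using \<open>m < j\<close> k(1) by (simp_all add: min_def)
      have "policy_adds Compact LS (take k w) {take m (take k w) @ drop (j - 1) (take k w)}"
        using policy_adds.compact[OF j \<open>m < j\<close>] compact.hyps unfolding t by blast
      then show ?thesis
        using j k(3) 2(1) reattach_index_imp_orphan unfolding t by blast
    qed
  qed
qed

section \<open>The computed tree as a function of \<open>LS\<close>\<close>

lemma computed_tree_iff:
  assumes "[] \<in> LS"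
  shows "computed_tree P LS LT \<longleftrightarrow>
    LT = {v. non_orphan LS v} \<union> \<Union>{B. \<exists>w. orphan LS w \<and> policy_adds P LS w B}"
proof -
  let ?T = "{v. non_orphan LS v} \<union> \<Union>{B. \<exists>w. orphan LS w \<and> policy_adds P LS w B}"
  \<comment> \<open>Each \<open>tree_upto LS A w\<close> contains \<open>A w\<close> and otherwise
    only non-orphan paths and additions of orphan paths, so the union over all \<open>w\<close>
    forgets the processing order.\<close>
  have eq: "{v. non_orphan LS v} \<union> (\<Union>w\<in>{w. orphan LS w}. tree_upto LS A w) = ?T"
    if A: "\<forall>w. orphan LS w \<longrightarrow> policy_adds P LS w (A w)" for A
  proof -
    have "policy_adds P LS w B \<longleftrightarrow> B = A w" if "orphan LS w" for w B
      using A that policy_adds_unique by metis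
    then have "{B. \<exists>w. orphan LS w \<and> policy_adds P LS w B} = A ` {w. orphan LS w}"
      by auto
    then show ?thesis by (auto simp: tree_upto_def)
  qed
  \<comment> \<open>Without some such \<open>A\<close> no set would satisfy
    \<open>computed_tree\<close>; the choice rests on \<open>[] \<in> LS\<close> through the
    existence of \<open>m\<close>.\<close>
  obtain A where A: "\<forall>w. orphan LS w \<longrightarrow> policy_adds P LS w (A w)"
    using choice[of "\<lambda>w B. orphan LS w \<longrightarrow> policy_adds P LS w B"] policy_adds_exists[OF assms]
    by blast
  show ?thesis
  proof
    assume "computed_tree P LS LT"
    then show "LT = ?T" unfolding computed_tree_def using eq by (elim exE conjE) simp
  next
    assume "LT = ?T"
    then show "computed_tree P LS LT"
      unfolding computed_tree_def using A eq[OF A] by (intro exI[of _ A]) simp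
  qed
qed

lemma computed_tree_unique:
  "[] \<in> LS \<Longrightarrow> computed_tree P LS S \<Longrightarrow> computed_tree P LS T \<Longrightarrow> S = T"
  by (simp add: computed_tree_iff)

lemma word_tree_computed_tree:
  assumes "[] \<in> LS" "computed_tree P LS LT"
  shows "word_tree LT"
proof -
  have LT: "LT = {v. non_orphan LS v} \<union> \<Union>{B. \<exists>w. orphan LS w \<and> policy_adds P LS w B}"
    using assms computed_tree_iff by blast
  have "p \<in> LT" if "p @ e \<in> LT" for p e
  proof -
    from that consider "non_orphan LS (p @ e)"
      | w B where "orphan LS w" "policy_adds P LS w B" "p @ e \<in> B"
      unfolding LT by blast
    then show ?thesis
    proof cases
      case 1
      then show ?thesis using non_orphan_append unfolding LT by blast
    next
      case 2
      then show ?thesis using policy_adds_prefix[OF 2(2) assms(1) 2(1,3)] unfolding LT by blast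
    qed
  qed
  moreover have "[] \<in> LT" unfolding LT using non_orphan_Nil[OF assms(1)] by blast
  ultimately show ?thesis unfolding word_tree_def by blast
qed

section \<open>Eventual consistency\<close>

lemma eventually_coincide_mono:
  assumes "eventually_coincide R V"
    and "\<And>r s t. V r t = V s t \<Longrightarrow> W r t = W s t"
  shows "eventually_coincide R W"
  using assms(1) unfolding eventually_coincide_def
  by (rule eventually_mono) (use assms(2) in blast)

theorem mainTheorem1:
  fixes P :: policy
  shows "(\<forall>LS :: ('a::linorder) list set. [] \<in> LS \<longrightarrow>
            (\<exists>!LT. computed_tree P LS LT) \<and>
            (\<forall>LT. computed_tree P LS LT \<longrightarrow> word_tree LT)) \<and>
         (\<forall>(U :: 'r \<Rightarrow> nat \<Rightarrow> 'u set) (LS :: 'r \<Rightarrow> nat \<Rightarrow> 'a list set) (LT :: 'r \<Rightarrow> nat \<Rightarrow> 'a list set).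
            (\<forall>r t. [] \<in> LS r t) \<longrightarrow>
            (\<forall>r t. computed_tree P (LS r t) (LT r t)) \<longrightarrow>
            (\<forall>R. eventually_coincide R LS \<longrightarrow> eventually_coincide R LT) \<and>
            (eventually_consistent U LS \<longrightarrow> eventually_consistent U LT))"
proof -
  have coincide: "eventually_coincide R LT"
    if "\<forall>r t. [] \<in> LS r t" "\<forall>r t. computed_tree P (LS r t) (LT r t)" "eventually_coincide R LS"
    for R and LS LT :: "'r \<Rightarrow> nat \<Rightarrow> 'a list set"
    using that(3)
    by (rule eventually_coincide_mono) (use that(1,2) computed_tree_unique in metis)
  have "eventually_consistent U LT"
    if "\<forall>r t. [] \<in> LS r t" "\<forall>r t. computed_tree P (LS r t) (LT r t)" "eventually_consistent U LS"
    for U :: "'r \<Rightarrow> nat \<Rightarrow> 'u set" and LS LT :: "'r \<Rightarrow> nat \<Rightarrow> 'a list set"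
    \<comment> \<open>Equal updates eventually give equal lookups, and these eventually give equal
      trees.\<close>
    using that(3) coincide[OF that(1,2)] unfolding eventually_consistent_def by blast
  with coincide show ?thesis
    \<comment> \<open>By \<open>computed_tree_iff\<close>, unique existence becomes that of a
      solution of \<open>LT = T\<close> for a fixed set \<open>T\<close>.\<close>
    by (intro conjI allI impI) (simp_all add: computed_tree_iff word_tree_computed_tree)
qed

end
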